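(* Let $\alpha,\beta,x,y,p\in\mathbb{C}$ with $\mathrm{Re}(p)>0$, $\mathrm{Re}(\alpha)>-1$, $\mathrm{Re}(x)>0$ and $\mathrm{Re}(1-y)>0$. Then $${}^{\Psi}B_{p}^{(\alpha,\beta)}(x,1-y)=\sum_{n=0}^{\infty}\frac{(y)_{n}}{n!}\;{}^{\Psi}B_{p}^{(\alpha,\beta)}(x+n,1).$$
   Context: For $\alpha,\beta\in\mathbb{C}$ with $\mathrm{Re}(\alpha)>-1$, the Wright function is ${}_{0}\Psi_{1}(\alpha,\beta;z)=\sum_{n=0}^{\infty}\frac{1}{\Gamma(\alpha n+\beta)}\frac{z^n}{n!}$ (with $1/\Gamma$ equal to $0$ at the poles of $\Gamma$). For $\mathrm{Re}(x)>0$, $\mathrm{Re}(y)>0$, $\mathrm{Re}(\alpha)>-1$, $\mathrm{Re}(p)>0$ the $\Psi$-beta function is $${}^{\Psi}B_{p}^{(\alpha,\beta)}(x,y)=\int_{0}^{1}t^{x-1}(1-t)^{y-1}\,{}_{0}\Psi_{1}\left(\alpha,\beta;-\frac{p}{t(1-t)}\right)dt.$$ $(\lambda)_n$ is the Pochhammer symbol: $(\lambda)_0=1$, $(\lambda)_n=\Gamma(\lambda+n)/\Gamma(\lambda)=\lambda(\lambda+1)\cdots(\lambda+n-1)$.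
   Formalization: The formal theorem additionally assumes that the integrals defining the Ψ-beta values on both sides converge absolutely; the stated conditions do not ensure this (for α=β=1, p=1+i the integrals diverge at the endpoints). *)

theory Defs
  imports "HOL-Analysis.Analysis"
begin

text \<open>The function \<open>rGamma\<close> is the entire function \<open>1 / \<Gamma>\<close>, which vanishes at the poles of \<open>\<Gamma>\<close>.\<close>

definition wright :: "complex \<Rightarrow> complex \<Rightarrow> complex \<Rightarrow> complex" where
  "wright \<alpha> \<beta> z = (\<Sum>n. rGamma (\<alpha> * of_nat n + \<beta>) * z ^ n / fact n)"

definition Psi_beta_integrand ::
  "complex \<Rightarrow> complex \<Rightarrow> complex \<Rightarrow> complex \<Rightarrow> complex \<Rightarrow> real \<Rightarrow> complex" where
  "Psi_beta_integrand \<alpha> \<beta> p x y t =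
     of_real t powr (x - 1) * of_real (1 - t) powr (y - 1) *
     wright \<alpha> \<beta> (- p / of_real (t * (1 - t)))"

definition Psi_beta ::
  "complex \<Rightarrow> complex \<Rightarrow> complex \<Rightarrow> complex \<Rightarrow> complex \<Rightarrow> complex" where
  "Psi_beta \<alpha> \<beta> p x y = (LINT t:{0<..<1}|lborel. Psi_beta_integrand \<alpha> \<beta> p x y t)"

text \<open>
  The conditions \<open>Re x > 0\<close>, \<open>Re y > 0\<close>, \<open>Re \<alpha> > -1\<close>, \<open>Re p > 0\<close> do not guarantee that the
  integral defining \<open>Psi_beta\<close> converges: the argument of the Wright function tends to infinity at
  both endpoints, where the function may grow. For instance \<open>wright 1 1 z\<close> is the modified Bessel
  function \<open>I\<^sub>0\<close> at \<open>2 * sqrt z\<close>, which grows exponentially along \<open>z = - p * s\<close>, \<open>s \<rightarrow> \<infinity>\<close>,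
  for every non-real \<open>p\<close>. A divergent Bochner integral has the value 0 by convention, so
  statements about values of \<open>Psi_beta\<close> need the following predicate.
\<close>

definition Psi_beta_defined ::
  "complex \<Rightarrow> complex \<Rightarrow> complex \<Rightarrow> complex \<Rightarrow> complex \<Rightarrow> bool" where
  "Psi_beta_defined \<alpha> \<beta> p x y \<longleftrightarrow>
     set_integrable lborel {0<..<1} (Psi_beta_integrand \<alpha> \<beta> p x y)"

end

theory Submission
  imports Defs
begin

text \<open>
  For \<open>0 < t < 1\<close> the binomial series is
  \<open>(1 - t) powr (- y) = (\<Sum>n. pochhammer y n / fact n * t ^ n)\<close>. Multiplying it by the integrand
  \<open>F t = Psi_beta_integrand \<alpha> \<beta> p x 1 t\<close> and integrating term by term gives the theorem, because
  a factor \<open>t ^ n\<close> shifts \<open>x\<close> to \<open>x + n\<close>.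

  The exchange of sum and integral is an instance of dominated convergence. A bound by the sum of
  the norms of the terms would not be good enough: for \<open>Re y = 0\<close>, \<open>y \<noteq> 0\<close> it is of size
  \<open>- ln (1 - t)\<close>, and integrability of \<open>F\<close> and of \<open>F t * (1 - t) powr (- y)\<close>
  says nothing about \<open>F t * ln (1 - t)\<close>. The partial sums themselves behave better; they are
  bounded by a constant multiple of \<open>1 + (1 - t) powr (- Re y)\<close>
  (lemma \<open>binomial_partial_sums_bound\<close>), which the two integrability hypotheses can pay for:

    \<^item> if \<open>Re y > 0\<close>, the coefficients are dominated by those of the binomial series with the
      real exponent \<open>- Re y\<close>, whose terms are positive and sum to \<open>(1 - t) powr (- Re y)\<close>;

    \<^item> if \<open>Re y \<le> 0\<close>, the partial sums up to index \<open>N\<close> at \<open>t = 1\<close> have the closed form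
      \<open>pochhammer (y + 1) N / fact N\<close>, which is at most of order \<open>N powr Re y\<close> and hence bounded, and
      summation by parts carries this bound over to all \<open>t\<close> in \<open>[0, 1]\<close>.

  Both growth rates come from Euler's limit formula for \<open>1 / \<Gamma>\<close>.
\<close>

section \<open>Growth of Pochhammer symbols\<close>

lemma norm_rGamma_series:
  fixes z :: complex
  assumes "n > 0"
  shows "norm (rGamma_series z n) = norm (pochhammer z (Suc n)) / (fact n * real n powr Re z)"
  using assms by (simp add: rGamma_series_def norm_mult norm_divide powr_def)

text \<open>
  Euler's formula says that \<open>pochhammer z (n + 1) / (fact n * n powr z)\<close> tends to \<open>1 / \<Gamma> z\<close>, and
  the modulus of \<open>n powr z\<close> depends on \<open>Re z\<close> only. So \<open>\<Gamma> (Re z) / \<Gamma> z\<close> is the limit of the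
  quotients in question, up to factors of modulus one.
\<close>
lemma norm_pochhammer_le_pochhammer_Re:
  fixes z :: complex
  assumes "Re z > 0"
  obtains C where "C \<ge> 0" "\<And>n. norm (pochhammer z n) \<le> C * pochhammer (Re z) n"
proof -
  have pos: "pochhammer (Re z) n > 0" for n
    using assms by (rule pochhammer_pos)
  have nonpos: "complex_of_real (Re z) \<notin> \<int>\<^sub>\<le>\<^sub>0"
    using assms by (auto simp: of_real_in_nonpos_Ints_iff elim!: nonpos_Ints_cases)
  have "(\<lambda>n. norm (rGamma_series z n) / norm (rGamma_series (complex_of_real (Re z)) n))
          \<longlonglongrightarrow> norm (rGamma z) / norm (rGamma (complex_of_real (Re z)))"
    using nonpos by (intro tendsto_divide tendsto_norm rGamma_series_LIMSEQ)
                    (simp add: rGamma_eq_zero_iff)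
  moreover have "eventually (\<lambda>n. norm (rGamma_series z n) /
                    norm (rGamma_series (complex_of_real (Re z)) n)
                  = norm (pochhammer z (Suc n)) / pochhammer (Re z) (Suc n)) sequentially"
    using eventually_gt_at_top[of "0::nat"]
  proof eventually_elim
    case (elim n)
    have "norm (pochhammer (complex_of_real (Re z)) (Suc n)) = pochhammer (Re z) (Suc n)"
      unfolding pochhammer_of_real norm_of_real using pos[of "Suc n"] by (rule abs_of_pos)
    with elim show ?case by (simp add: norm_rGamma_series del: pochhammer_Suc)
  qed
  ultimately have "(\<lambda>n. norm (pochhammer z (Suc n)) / pochhammer (Re z) (Suc n))
      \<longlonglongrightarrow> norm (rGamma z) / norm (rGamma (complex_of_real (Re z)))"
    by (rule Lim_transform_eventually)
  then have "convergent (\<lambda>n. norm (pochhammer z n) / pochhammer (Re z) n)"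
    by (rule convergentI[OF LIMSEQ_imp_Suc])
  then have "Bseq (\<lambda>n. norm (pochhammer z n) / pochhammer (Re z) n)"
    by (rule convergent_imp_Bseq)
  then obtain C where "C > 0" and C: "\<forall>n. norm (norm (pochhammer z n) / pochhammer (Re z) n) \<le> C"
    by (rule BseqE)
  have "norm (pochhammer z n) \<le> C * pochhammer (Re z) n" for n
    using C[rule_format, of n] pos[of n] by (simp add: divide_le_eq)
  with \<open>C > 0\<close> show ?thesis by (intro that[of C]) auto
qed

text \<open>
  The case \<open>z = 0\<close> is separate because \<open>pochhammer 1 n\<close> can only be recovered from
  \<open>pochhammer z (Suc n) = z * pochhammer (z + 1) n\<close>, whose growth Euler's formula controls, if
  \<open>z\<close> can be divided out.
\<close>
lemma norm_pochhammer_plus_one_le_fact: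
  fixes z :: complex
  assumes "Re z \<le> 0"
  obtains C where "C \<ge> 0" "\<And>n. norm (pochhammer (z + 1) n) \<le> C * fact n"
proof (cases "z = 0")
  case True
  then show ?thesis by (intro that[of 1]) (auto simp flip: pochhammer_fact)
next
  case False
  have "convergent (rGamma_series z)"
    using rGamma_series_LIMSEQ convergent_def by blast
  then obtain C where "C > 0" and C: "\<And>n. norm (rGamma_series z n) \<le> C"
    using convergent_imp_Bseq BseqE by metis
  have "norm (pochhammer (z + 1) n) \<le> max 1 (C / norm z) * fact n" for n
  proof (cases "n = 0")
    case n: False
    have "norm z * norm (pochhammer (z + 1) n) = norm (pochhammer z (Suc n))"
      by (simp add: pochhammer_rec norm_mult)
    also have "\<dots> = norm (rGamma_series z n) * (fact n * real n powr Re z)"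
      using n by (simp add: norm_rGamma_series)
    also have "\<dots> \<le> C * (fact n * 1)"
    proof (intro mult_mono)
      show "real n powr Re z \<le> 1"
        using n assms powr_mono[of "Re z" 0 "real n"] by simp
    qed (use C \<open>C > 0\<close> in auto)
    finally have "norm (pochhammer (z + 1) n) \<le> C / norm z * fact n"
      using False by (simp add: field_simps)
    also have "\<dots> \<le> max 1 (C / norm z) * fact n"
      by (intro mult_right_mono) auto
    finally show ?thesis .
  qed auto
  then show ?thesis by (intro that[of "max 1 (C / norm z)"]) auto
qed

section \<open>Partial sums of the binomial series\<close>

lemma binomial_series_sums:
  assumes "0 < t" "t < 1"
  shows "(\<lambda>n. pochhammer y n / fact n * of_real t ^ n) sums (of_real (1 - t) powr (- y) :: complex)"
proof -
  have "(\<lambda>n. ((- y) gchoose n) * (- of_real t) ^ n) sums (1 + - complex_of_real t) powr (- y)"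
    using assms by (intro gen_binomial_complex) auto
  moreover have "((- y) gchoose n) * (- of_real t) ^ n = pochhammer y n / fact n * of_real t ^ n"
    for n
    by (simp add: gbinomial_pochhammer power_minus[of "complex_of_real t"] flip: power_add mult_2)
  ultimately show ?thesis by simp
qed

lemma real_binomial_series_sums:
  fixes r t :: real
  assumes "0 < t" "t < 1"
  shows "(\<lambda>n. pochhammer r n / fact n * t ^ n) sums (1 - t) powr (- r)"
proof -
  have "(\<lambda>n. ((- r) gchoose n) * (- t) ^ n) sums (1 + - t) powr (- r)"
    using assms by (intro gen_binomial_real) auto
  moreover have "((- r) gchoose n) * (- t) ^ n = pochhammer r n / fact n * t ^ n" for n
    by (simp add: gbinomial_pochhammer power_minus[of t] flip: power_add mult_2)
  ultimately show ?thesis by simp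
qed

lemma sum_pochhammer_div_fact:
  fixes y :: "'a :: field_char_0"
  shows "(\<Sum>n<Suc N. pochhammer y n / fact n) = pochhammer (y + 1) N / fact N"
proof (induction N)
  case (Suc N)
  have "(\<Sum>n<Suc (Suc N). pochhammer y n / fact n)
      = pochhammer (y + 1) N / fact N + y * pochhammer (y + 1) N / fact (Suc N)"
    using Suc by (simp add: pochhammer_rec)
  also have "\<dots> = pochhammer (y + 1) (Suc N) / fact (Suc N)"
    by (simp add: pochhammer_Suc divide_simps del: of_nat_Suc) (simp add: algebra_simps)
  finally show ?case .
qed auto

text \<open>
  Summation by parts writes the sum as an average of the partial sums of \<open>a\<close> with the weights
  \<open>(1 - t) * t ^ k\<close> and \<open>t ^ N\<close>, which are nonnegative and add up to one.
\<close>
lemma norm_power_sum_le_Abel: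
  fixes a :: "nat \<Rightarrow> complex"
  assumes t: "0 \<le> t" "t \<le> 1" and C: "\<And>k. norm (\<Sum>n<k. a n) \<le> C"
  shows "norm (\<Sum>n<N. a n * of_real t ^ n) \<le> C"
proof -
  let ?s = "\<lambda>k. \<Sum>n<k. a n"
  have "norm ((\<Sum>n<N. a n * of_real t ^ n) - of_real t ^ N * ?s N) \<le> C * (1 - t ^ N)" for N
  proof (induction N)
    case (Suc N)
    let ?g = "(\<Sum>n<N. a n * of_real t ^ n) - of_real t ^ N * ?s N"
    have "norm ((\<Sum>n<Suc N. a n * of_real t ^ n) - of_real t ^ Suc N * ?s (Suc N))
        = norm (?g + of_real (t ^ N * (1 - t)) * ?s (Suc N))"
      by (simp add: algebra_simps)
    also have "\<dots> \<le> norm ?g + t ^ N * (1 - t) * norm (?s (Suc N))"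
      by (rule order_trans[OF norm_triangle_ineq]) (use t in \<open>simp only: norm_mult norm_of_real, simp\<close>)
    also have "\<dots> \<le> C * (1 - t ^ N) + t ^ N * (1 - t) * C"
      using t by (intro add_mono Suc mult_left_mono C) auto
    finally show ?case by (simp add: algebra_simps)
  qed auto
  then have "norm (\<Sum>n<N. a n * of_real t ^ n) \<le> C * (1 - t ^ N) + norm (of_real t ^ N * ?s N)"
    by (smt (verit, best) norm_triangle_sub)
  also have "norm (of_real t ^ N * ?s N) \<le> t ^ N * C"
    using t mult_left_mono[OF C, of "t ^ N"] by (simp add: norm_mult norm_power)
  finally show ?thesis by (simp add: algebra_simps)
qed

text \<open>
  The constant \<open>1\<close> on the right covers the exponents with \<open>Re y \<le> 0\<close>, where the power of
  \<open>1 - t\<close> may tend to zero but the partial sums need not.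
\<close>
lemma binomial_partial_sums_bound:
  fixes y :: complex
  obtains C where "C \<ge> 0"
    "\<And>N t. 0 < t \<Longrightarrow> t < 1 \<Longrightarrow>
       norm (\<Sum>n<N. pochhammer y n / fact n * of_real t ^ n) \<le> C * (1 + (1 - t) powr (- Re y))"
proof (cases "Re y > 0")
  case True
  then obtain C where "C \<ge> 0" and C: "\<And>n. norm (pochhammer y n) \<le> C * pochhammer (Re y) n"
    using norm_pochhammer_le_pochhammer_Re by blast
  have "norm (\<Sum>n<N. pochhammer y n / fact n * of_real t ^ n) \<le> C * (1 + (1 - t) powr (- Re y))"
    if t: "0 < t" "t < 1" for N t
  proof -
    have "norm (\<Sum>n<N. pochhammer y n / fact n * of_real t ^ n)
        \<le> (\<Sum>n<N. norm (pochhammer y n) / fact n * t ^ n)"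
      using t by (intro sum_norm_le) (simp add: norm_mult norm_divide norm_power)
    also have "\<dots> \<le> (\<Sum>n<N. C * pochhammer (Re y) n / fact n * t ^ n)"
      using t C by (intro sum_mono mult_right_mono divide_right_mono) auto
    also have "\<dots> = C * (\<Sum>n<N. pochhammer (Re y) n / fact n * t ^ n)"
      by (simp add: sum_distrib_left mult_ac)
    also have "\<dots> \<le> C * (1 + (1 - t) powr (- Re y))"
    proof (rule mult_left_mono[OF _ \<open>C \<ge> 0\<close>])
      have "(\<Sum>n<N. pochhammer (Re y) n / fact n * t ^ n) \<le> (1 - t) powr (- Re y)"
        unfolding sums_unique[OF real_binomial_series_sums[OF t]]
        using t True
        by (intro sum_le_suminf sums_summable[OF real_binomial_series_sums[OF t]])
           (auto intro!: mult_nonneg_nonneg divide_nonneg_nonneg pochhammer_nonneg)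
      then show "(\<Sum>n<N. pochhammer (Re y) n / fact n * t ^ n) \<le> 1 + (1 - t) powr (- Re y)"
        by simp
    qed
    finally show ?thesis .
  qed
  with \<open>C \<ge> 0\<close> that show ?thesis by blast
next
  case False
  then obtain C where "C \<ge> 0" and C: "\<And>n. norm (pochhammer (y + 1) n) \<le> C * fact n"
    using norm_pochhammer_plus_one_le_fact[of y] by auto
  have "norm (\<Sum>n<N. pochhammer y n / fact n) \<le> C" for N
  proof (cases N)
    case (Suc M)
    show ?thesis
      using C[of M] unfolding Suc sum_pochhammer_div_fact by (simp add: norm_divide divide_le_eq)
  qed (use \<open>C \<ge> 0\<close> in auto)
  then have "norm (\<Sum>n<N. pochhammer y n / fact n * of_real t ^ n) \<le> C"
    if "0 < t" "t < 1" for N t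
    using that by (intro norm_power_sum_le_Abel) auto
  moreover have "C \<le> C * (1 + (1 - t) powr (- Re y))" for t
    using \<open>C \<ge> 0\<close> by (simp add: algebra_simps)
  ultimately show ?thesis
    using \<open>C \<ge> 0\<close> that[of C] order_trans by blast
qed

section \<open>Termwise integration\<close>

text \<open>
  The bound on the partial sums makes \<open>C * (norm (F t) + norm (F t * (1 - t) powr (- y)))\<close> a
  dominating function: \<open>(1 - t) powr (- Re y)\<close> is the modulus of \<open>(1 - t) powr (- y)\<close>, so the
  two hypotheses are exactly the integrability of its two parts.
\<close>
theorem integral_times_binomial_series:
  fixes F :: "real \<Rightarrow> complex"
  assumes F: "set_integrable lborel {0<..<1} F"
    and Fy: "set_integrable lborel {0<..<1} (\<lambda>t. F t * of_real (1 - t) powr (- y))"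
  shows "(\<lambda>n. pochhammer y n / fact n * (LINT t:{0<..<1}|lborel. F t * of_real t ^ n)) sums
           (LINT t:{0<..<1}|lborel. F t * of_real (1 - t) powr (- y))"
proof -
  let ?I = "{0<..<1::real}"
  define G where "G = (\<lambda>t. indicator ?I t *\<^sub>R F t)"
  define H where "H = (\<lambda>t. indicator ?I t *\<^sub>R (F t * of_real (1 - t) powr (- y)))"
  define S where "S = (\<lambda>N t. \<Sum>n<N. pochhammer y n / fact n * complex_of_real t ^ n)"
  obtain C where "C \<ge> 0" and
    C: "\<And>N t. 0 < t \<Longrightarrow> t < 1 \<Longrightarrow> norm (S N t) \<le> C * (1 + (1 - t) powr (- Re y))"
    unfolding S_def using binomial_partial_sums_bound by metis
  have G: "integrable lborel G" and H: "integrable lborel H"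
    using F Fy by (simp_all add: G_def H_def set_integrable_def)
  have [measurable]: "G \<in> borel_measurable borel" "H \<in> borel_measurable borel"
    using borel_measurable_integrable[OF G] borel_measurable_integrable[OF H] by simp_all
  have G_power: "integrable lborel (\<lambda>t. G t * of_real t ^ n)" for n
  proof (rule Bochner_Integration.integrable_bound[OF G])
    show "AE t in lborel. norm (G t * of_real t ^ n) \<le> norm (G t)"
      by (intro always_eventually)
         (auto simp: G_def indicator_def norm_mult norm_power intro!: mult_left_le power_le_one)
  qed measurable
  have "(\<lambda>N. \<integral>t. G t * S N t \<partial>lborel) \<longlonglongrightarrow> (\<integral>t. H t \<partial>lborel)"
  proof (rule integral_dominated_convergence[where w = "\<lambda>t. C * (norm (G t) + norm (H t))"])
    show "integrable lborel (\<lambda>t. C * (norm (G t) + norm (H t)))"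
      using G H by auto
    show "AE t in lborel. (\<lambda>N. G t * S N t) \<longlonglongrightarrow> H t"
    proof (intro always_eventually allI)
      fix t :: real
      show "(\<lambda>N. G t * S N t) \<longlonglongrightarrow> H t"
      proof (cases "t \<in> ?I")
        case True
        then have "(\<lambda>N. S N t) \<longlonglongrightarrow> of_real (1 - t) powr (- y)"
          using binomial_series_sums[of t y] by (simp add: S_def sums_def)
        from tendsto_mult_left[OF this, of "F t"] True show ?thesis
          by (simp add: G_def H_def)
      qed (simp add: G_def H_def)
    qed
    show "AE t in lborel. norm (G t * S N t) \<le> C * (norm (G t) + norm (H t))" for N
    proof (intro always_eventually allI)
      fix t :: real
      show "norm (G t * S N t) \<le> C * (norm (G t) + norm (H t))"
      proof (cases "t \<in> ?I")
        case True
        then have "norm (H t) = norm (G t) * (1 - t) powr (- Re y)"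
          using norm_powr_real_powr[of "complex_of_real (1 - t)" "- y"]
          by (simp add: G_def H_def norm_mult)
        moreover have "norm (G t) * norm (S N t) \<le> norm (G t) * (C * (1 + (1 - t) powr (- Re y)))"
          using True by (intro mult_left_mono C) auto
        ultimately show ?thesis by (simp add: norm_mult algebra_simps)
      qed (simp add: G_def H_def)
    qed
  qed (simp_all add: S_def)
  also have "(\<lambda>N. \<integral>t. G t * S N t \<partial>lborel)
      = (\<lambda>N. \<Sum>n<N. pochhammer y n / fact n * (\<integral>t. G t * of_real t ^ n \<partial>lborel))"
  proof
    fix N
    have "G t * S N t = (\<Sum>n<N. pochhammer y n / fact n * (G t * of_real t ^ n))" for t
      by (simp add: S_def sum_distrib_left mult_ac)
    then show "(\<integral>t. G t * S N t \<partial>lborel)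
        = (\<Sum>n<N. pochhammer y n / fact n * (\<integral>t. G t * of_real t ^ n \<partial>lborel))"
      using G_power by (simp add: Bochner_Integration.integral_sum)
  qed
  finally show ?thesis
    by (simp add: sums_def G_def H_def set_lebesgue_integral_def)
qed

lemma Psi_beta_integrand_shift:
  assumes "0 < t" "t < 1"
  shows "Psi_beta_integrand \<alpha> \<beta> p (x + of_nat n) 1 t
       = Psi_beta_integrand \<alpha> \<beta> p x 1 t * of_real t ^ n"
proof -
  have "complex_of_real t powr (x + of_nat n - 1) = of_real t powr ((x - 1) + of_nat n)"
    by (simp add: algebra_simps)
  also have "\<dots> = of_real t powr (x - 1) * of_real t ^ n"
    using assms by (simp only: powr_add powr_nat') simp
  finally show ?thesis by (simp add: Psi_beta_integrand_def)
qed

lemma Psi_beta_integrand_one_minus: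
  assumes "0 < t" "t < 1"
  shows "Psi_beta_integrand \<alpha> \<beta> p x (1 - y) t
       = Psi_beta_integrand \<alpha> \<beta> p x 1 t * of_real (1 - t) powr (- y)"
proof -
  have "of_real (1 - t) powr (0::complex) = 1"
    using assms by simp
  then show ?thesis by (simp add: Psi_beta_integrand_def)
qed

theorem theorem2p6:
  fixes \<alpha> \<beta> x y p :: complex
  assumes "Re p > 0" and "Re \<alpha> > -1" and "Re x > 0" and "Re (1 - y) > 0"
    and "Psi_beta_defined \<alpha> \<beta> p x (1 - y)"
    and "\<And>n::nat. Psi_beta_defined \<alpha> \<beta> p (x + of_nat n) 1"
  shows "(\<lambda>n. pochhammer y n / fact n * Psi_beta \<alpha> \<beta> p (x + of_nat n) 1)
           sums Psi_beta \<alpha> \<beta> p x (1 - y)"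
proof -
  let ?F = "Psi_beta_integrand \<alpha> \<beta> p x 1"
  have "set_integrable lborel {0<..<1} ?F"
    using assms(6)[of 0] by (simp add: Psi_beta_defined_def)
  moreover have "set_integrable lborel {0<..<1} (\<lambda>t. ?F t * of_real (1 - t) powr (- y))"
    using assms(5) unfolding Psi_beta_defined_def
    by (subst set_integrable_cong[OF refl refl, of _ _ "Psi_beta_integrand \<alpha> \<beta> p x (1 - y)"])
       (auto simp: Psi_beta_integrand_one_minus)
  ultimately have "(\<lambda>n. pochhammer y n / fact n * (LINT t:{0<..<1}|lborel. ?F t * of_real t ^ n))
      sums (LINT t:{0<..<1}|lborel. ?F t * of_real (1 - t) powr (- y))"
    by (rule integral_times_binomial_series)
  moreover have "(LINT t:{0<..<1}|lborel. ?F t * of_real t ^ n) = Psi_beta \<alpha> \<beta> p (x + of_nat n) 1"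
    for n
    unfolding Psi_beta_def
    by (rule set_lebesgue_integral_cong) (auto simp: Psi_beta_integrand_shift)
  moreover have "(LINT t:{0<..<1}|lborel. ?F t * of_real (1 - t) powr (- y))
      = Psi_beta \<alpha> \<beta> p x (1 - y)"
    unfolding Psi_beta_def
    by (rule set_lebesgue_integral_cong) (auto simp: Psi_beta_integrand_one_minus)
  ultimately show ?thesis by simp
qed

end
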